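(* The region of the local stability for Model GR is a proper subset of that for Model GL. That is, $\Omega_{GR}\subsetneq\Omega_{GL}$, where $\Omega_{GR}$ and $\Omega_{GL}$ are the sets of parameters $(c_1,c_2,\delta)$ with $c_1,c_2,\delta>0$ for which the unique positive equilibrium of Model GR, respectively Model GL, is locally stable.
   Context: Parameters: $c_1,c_2,\delta>0$. For $x_1,x_2>0$, $$G_1(x_1,x_2)=\frac{x_1x_2}{(x_1+x_2)^2}-2c_1x_1^2 .$$ For $x_1>0$, $R_2(x_1)$ denotes the unique positive solution $x_2$ of the cubic equation $x_1-2c_2x_2(x_2+x_1)^2=0$. Model GR: $x_1(t+1)=x_1(t)+\delta G_1(x_1(t),x_2(t))$, $x_2(t+1)=R_2(x_1(t+1))$; it is equivalently described by the one-dimensional map $x_1\mapsto x_1+\delta G_1(x_1,R_2(x_1))$ with $x_2=R_2(x_1)$. Model GL: $x_1(t+1)=x_1(t)+\delta G_1(x_1(t),x_2(t))$, $\;x_2(t+1)=\dfrac{2x_2(t)+x_1(t)}{2\left(1+c_2(x_1(t)+x_2(t))^2\right)}$, a two-dimensional map. Both models have the same unique equilibrium (fixed point) with $x_1,x_2>0$: $$(x_1,x_2)=\left(\frac{\sqrt{c_2}}{\sqrt{c_1}+\sqrt{c_2}}\,\frac{1}{\sqrt{2\sqrt{c_1c_2}}},\ \frac{\sqrt{c_1}}{\sqrt{c_1}+\sqrt{c_2}}\,\frac{1}{\sqrt{2\sqrt{c_1c_2}}}\right).$$ Local stability is understood by the linearized criterion: for Model GR, the derivative $DQ$ of the one-dimensional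 map at the equilibrium satisfies $|DQ|<1$; for Model GL, all eigenvalues of the $2\times2$ Jacobian matrix of the map at the equilibrium lie in the open unit disk. *)

theory Defs
  imports "HOL-Analysis.Analysis"
begin

definition G1 :: "real \<Rightarrow> real \<Rightarrow> real \<Rightarrow> real" where
  "G1 c1 x1 x2 = x1 * x2 / (x1 + x2)^2 - 2 * c1 * x1^2"

definition R2 :: "real \<Rightarrow> real \<Rightarrow> real" where
  "R2 c2 x1 = (THE x2. 0 < x2 \<and> x1 - 2 * c2 * x2 * (x2 + x1)^2 = 0)"

definition GR_map :: "real \<Rightarrow> real \<Rightarrow> real \<Rightarrow> real \<Rightarrow> real" where
  "GR_map c1 c2 \<delta> x1 = x1 + \<delta> * G1 c1 x1 (R2 c2 x1)"

definition GL_map :: "real \<Rightarrow> real \<Rightarrow> real \<Rightarrow> real^2 \<Rightarrow> real^2" where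
  "GL_map c1 c2 \<delta> x = vector
     [x$1 + \<delta> * G1 c1 (x$1) (x$2),
      (2 * x$2 + x$1) / (2 * (1 + c2 * (x$1 + x$2)^2))]"

text \<open>Model GR lives on the curve \<open>x2 = R2 x1\<close>, so its positive equilibrium is represented by its
  first coordinate. Existence and uniqueness of both equilibria are proved below, in
  \<open>GR_positive_equilibrium\<close> and \<open>GL_positive_equilibrium\<close>.\<close>

definition GR_equilibrium :: "real \<Rightarrow> real \<Rightarrow> real \<Rightarrow> real" where
  "GR_equilibrium c1 c2 \<delta> = (THE x1. 0 < x1 \<and> GR_map c1 c2 \<delta> x1 = x1)"

definition GL_equilibrium :: "real \<Rightarrow> real \<Rightarrow> real \<Rightarrow> real^2" where
  "GL_equilibrium c1 c2 \<delta> = (THE x. 0 < x$1 \<and> 0 < x$2 \<and> GL_map c1 c2 \<delta> x = x)"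

definition matrix_eigenvalue :: "complex^'n^'n \<Rightarrow> complex \<Rightarrow> bool" where
  "matrix_eigenvalue A \<mu> \<longleftrightarrow> (\<exists>v. v \<noteq> 0 \<and> A *v v = \<mu> *s v)"

text \<open>Differentiability is required explicitly because \<^const>\<open>deriv\<close> and \<^const>\<open>jacobian\<close> are
  arbitrary at points where the derivative does not exist.\<close>

definition locally_stable_1d :: "(real \<Rightarrow> real) \<Rightarrow> real \<Rightarrow> bool" where
  "locally_stable_1d f x \<longleftrightarrow> f differentiable (at x) \<and> \<bar>deriv f x\<bar> < 1"

definition locally_stable :: "(real^'n \<Rightarrow> real^'n) \<Rightarrow> real^'n \<Rightarrow> bool" where
  "locally_stable f x \<longleftrightarrow> f differentiable (at x) \<and>
     (\<forall>\<mu>. matrix_eigenvalue (map_matrix complex_of_real (jacobian f (at x))) \<mu> \<longrightarrow> norm \<mu> < 1)"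

definition Omega_GR :: "(real \<times> real \<times> real) set" where
  "Omega_GR = {(c1, c2, \<delta>). 0 < c1 \<and> 0 < c2 \<and> 0 < \<delta> \<and>
     locally_stable_1d (GR_map c1 c2 \<delta>) (GR_equilibrium c1 c2 \<delta>)}"

definition Omega_GL :: "(real \<times> real \<times> real) set" where
  "Omega_GL = {(c1, c2, \<delta>). 0 < c1 \<and> 0 < c2 \<and> 0 < \<delta> \<and>
     locally_stable (GL_map c1 c2 \<delta>) (GL_equilibrium c1 c2 \<delta>)}"

lemma R2_ex1:
  fixes c2 x1 :: real
  assumes "0 < c2" "0 < x1"
  shows "\<exists>!x2. 0 < x2 \<and> x1 - 2 * c2 * x2 * (x2 + x1)^2 = 0"
proof (rule ex_ex1I)
  let ?f = "\<lambda>y. 2 * c2 * y * (y + x1)^2"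
  define b where "b = 1 / (2 * c2 * x1)"
  have b: "0 < b" using assms by (simp add: b_def)
  have "x1 = 2 * c2 * b * x1^2"
    using assms by (simp add: b_def power2_eq_square)
  also have "\<dots> \<le> ?f b"
    using assms b by (intro mult_left_mono power_mono) auto
  finally have "x1 \<le> ?f b" .
  then have "\<exists>y\<ge>0. y \<le> b \<and> ?f y = x1"
    using assms b by (intro IVT') (auto intro!: continuous_intros)
  then obtain y where y: "0 \<le> y" "?f y = x1" by blast
  with assms have "y \<noteq> 0" by auto
  with y show "\<exists>x2. 0 < x2 \<and> x1 - ?f x2 = 0" by (intro exI[of _ y]) auto
next
  fix y z :: real
  assume y: "0 < y \<and> x1 - 2 * c2 * y * (y + x1)^2 = 0"
    and z: "0 < z \<and> x1 - 2 * c2 * z * (z + x1)^2 = 0"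
  have mono: "2 * c2 * u * (u + x1)^2 < 2 * c2 * v * (v + x1)^2" if "0 < u" "u < v" for u v
  proof -
    have "u * (u + x1)^2 < v * (v + x1)^2"
      using assms that by (intro mult_strict_mono power_strict_mono) auto
    then show ?thesis using assms by (simp add: mult.assoc)
  qed
  show "y = z"
    using mono[of y z] mono[of z y] y z by (cases y z rule: linorder_cases) auto
qed

lemma R2_eq_iff:
  fixes c2 x1 x2 :: real
  assumes "0 < c2" "0 < x1"
  shows "R2 c2 x1 = x2 \<longleftrightarrow> 0 < x2 \<and> x1 - 2 * c2 * x2 * (x2 + x1)^2 = 0"
  unfolding R2_def using theI'[OF R2_ex1[OF assms]] R2_ex1[OF assms] by blast

lemma equilibrium_equations_iff:
  fixes c1 c2 x y :: real
  assumes c: "0 < c1" "0 < c2" and pos: "0 < x" "0 < y"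
  shows "G1 c1 x y = 0 \<and> x - 2 * c2 * y * (y + x)^2 = 0 \<longleftrightarrow>
     x = sqrt c2 / (sqrt c1 + sqrt c2) * (1 / sqrt (2 * sqrt (c1 * c2))) \<and>
     y = sqrt c1 / (sqrt c1 + sqrt c2) * (1 / sqrt (2 * sqrt (c1 * c2)))"
proof -
  define p where "p = sqrt c1"
  define q where "q = sqrt c2"
  define s where "s = 1 / sqrt (2 * sqrt (c1 * c2))"
  have pq: "0 < p" "0 < q" and c_eq: "c1 = p^2" "c2 = q^2"
    using c by (simp_all add: p_def q_def)
  have s: "0 < s" using c by (simp add: s_def)
  have s2: "2 * p * q * s^2 = 1"
    using c by (simp add: s_def p_def q_def real_sqrt_mult power_divide power_mult_distrib)
  have G: "G1 c1 x y = 0 \<longleftrightarrow> y = 2 * p^2 * x * (x + y)^2"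
  proof -
    have w: "(x + y)^2 \<noteq> 0" using pos by simp
    have "G1 c1 x y = 0 \<longleftrightarrow> x * y / (x + y)^2 = 2 * p^2 * x^2"
      by (simp add: G1_def c_eq)
    also have "\<dots> \<longleftrightarrow> x * y = 2 * p^2 * x^2 * (x + y)^2"
      using w by (simp only: divide_eq_eq if_True not_False_eq_True)
    also have "\<dots> \<longleftrightarrow> x * y = x * (2 * p^2 * x * (x + y)^2)"
      by (simp add: power2_eq_square mult_ac)
    finally show ?thesis using pos by simp
  qed
  have "(y = 2 * p^2 * x * (x + y)^2 \<and> x = 2 * q^2 * y * (x + y)^2) \<longleftrightarrow>
      x = q / (p + q) * s \<and> y = p / (p + q) * s" (is "?L \<longleftrightarrow> ?R")
  proof
    assume L: ?L
    define w where "w = (x + y)^2"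
    have w: "0 < w" using pos by (simp add: w_def)
    have 1: "y = 2 * p^2 * x * w" and 2: "x = 2 * q^2 * y * w"
      using L by (simp_all add: w_def)
    have "(q * y)^2 * (2 * w) = (p * x)^2 * (2 * w)"
    proof -
      have "(q * y)^2 * (2 * w) = y * (2 * q^2 * y * w)" by (simp add: power2_eq_square)
      also have "\<dots> = x * (2 * p^2 * x * w)"
        unfolding 1[symmetric] 2[symmetric] by (rule mult.commute)
      also have "\<dots> = (p * x)^2 * (2 * w)" by (simp add: power2_eq_square)
      finally show ?thesis .
    qed
    then have "(q * y)^2 = (p * x)^2" using w by simp
    then have qy: "q * y = p * x"
      using pq pos by (simp add: power2_eq_iff_nonneg)
    have "q * y = q * (2 * p^2 * x * w)" using 1 by (rule arg_cong)
    also have "\<dots> = 2 * p * q * w * (p * x)" by (simp add: power2_eq_square)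
    finally have "q * y = 2 * p * q * w * (p * x)" .
    then have "2 * p * q * w = 1" using qy pq pos by simp
    then have "2 * p * q * w = 2 * p * q * s^2" using s2 by simp
    then have "(x + y)^2 = s^2" using pq by (simp add: w_def)
    then have xy: "x + y = s" using s pos by (simp add: power2_eq_iff_nonneg)
    have "(p + q) * x = q * (x + y)" "(p + q) * y = p * (x + y)"
      using qy by (simp_all add: algebra_simps)
    then show ?R using xy pq by (simp add: field_simps)
  next
    assume R: ?R
    have "x + y = (q / (p + q) + p / (p + q)) * s"
      using R by (simp only: distrib_right)
    also have "q / (p + q) + p / (p + q) = 1"
      using pq by (simp add: add_divide_distrib[symmetric] add.commute)
    finally have xy: "x + y = s" by simp
    have px: "p * x = q * y" using R by simp
    have "q * (2 * p^2 * x * s^2) = (2 * p * q * s^2) * (p * x)"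
      by (simp add: power2_eq_square)
    then have "q * (2 * p^2 * x * s^2) = q * y"
      unfolding s2 px by simp
    then have 1: "2 * p^2 * x * s^2 = y" using pq by (simp only: mult_cancel_left) simp
    have "p * (2 * q^2 * y * s^2) = (2 * p * q * s^2) * (q * y)"
      by (simp add: power2_eq_square)
    then have "p * (2 * q^2 * y * s^2) = p * x"
      unfolding s2 px by simp
    then have 2: "2 * q^2 * y * s^2 = x" using pq by (simp only: mult_cancel_left) simp
    show ?L unfolding xy using 1 2 by simp
  qed
  moreover have "x - 2 * c2 * y * (y + x)^2 = 0 \<longleftrightarrow> x = 2 * q^2 * y * (x + y)^2"
    by (simp add: c_eq add.commute)
  ultimately show ?thesis
    unfolding G by (simp only: p_def q_def s_def)
qed

theorem GR_positive_equilibrium: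
  fixes c1 c2 \<delta> x1 :: real
  assumes "0 < c1" "0 < c2" "0 < \<delta>"
  shows "0 < x1 \<and> GR_map c1 c2 \<delta> x1 = x1 \<longleftrightarrow>
      x1 = sqrt c2 / (sqrt c1 + sqrt c2) * (1 / sqrt (2 * sqrt (c1 * c2)))"
    and "R2 c2 (sqrt c2 / (sqrt c1 + sqrt c2) * (1 / sqrt (2 * sqrt (c1 * c2)))) =
      sqrt c1 / (sqrt c1 + sqrt c2) * (1 / sqrt (2 * sqrt (c1 * c2)))"
    and "GR_equilibrium c1 c2 \<delta> = sqrt c2 / (sqrt c1 + sqrt c2) * (1 / sqrt (2 * sqrt (c1 * c2)))"
proof -
  let ?a = "sqrt c2 / (sqrt c1 + sqrt c2) * (1 / sqrt (2 * sqrt (c1 * c2)))"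
  let ?b = "sqrt c1 / (sqrt c1 + sqrt c2) * (1 / sqrt (2 * sqrt (c1 * c2)))"
  have ab: "0 < ?a" "0 < ?b"
    using assms by (auto intro!: mult_pos_pos divide_pos_pos add_pos_pos)
  have eq: "G1 c1 ?a ?b = 0 \<and> ?a - 2 * c2 * ?b * (?b + ?a)^2 = 0"
    using equilibrium_equations_iff[OF assms(1,2) ab] by blast
  show R: "R2 c2 ?a = ?b"
    using R2_eq_iff[OF assms(2) ab(1)] eq ab(2) by blast
  have *: "0 < x1 \<and> GR_map c1 c2 \<delta> x1 = x1 \<longleftrightarrow> x1 = ?a" for x1
  proof
    assume x: "0 < x1 \<and> GR_map c1 c2 \<delta> x1 = x1"
    then have "G1 c1 x1 (R2 c2 x1) = 0" using assms by (simp add: GR_map_def)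
    then show "x1 = ?a"
      using x R2_eq_iff[OF assms(2), of x1 "R2 c2 x1"]
        equilibrium_equations_iff[OF assms(1,2), of x1 "R2 c2 x1"] by blast
  next
    assume "x1 = ?a"
    then show "0 < x1 \<and> GR_map c1 c2 \<delta> x1 = x1"
      using ab(1) eq R by (simp only: GR_map_def) simp
  qed
  show "0 < x1 \<and> GR_map c1 c2 \<delta> x1 = x1 \<longleftrightarrow> x1 = ?a" by (rule *)
  show "GR_equilibrium c1 c2 \<delta> = ?a"
    unfolding GR_equilibrium_def * by (rule the_eq_trivial)
qed

theorem GL_positive_equilibrium:
  fixes c1 c2 \<delta> :: real and x :: "real^2"
  assumes "0 < c1" "0 < c2" "0 < \<delta>"
  shows "0 < x$1 \<and> 0 < x$2 \<and> GL_map c1 c2 \<delta> x = x \<longleftrightarrow>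
      x = vector [sqrt c2 / (sqrt c1 + sqrt c2) * (1 / sqrt (2 * sqrt (c1 * c2))),
                  sqrt c1 / (sqrt c1 + sqrt c2) * (1 / sqrt (2 * sqrt (c1 * c2)))]"
    and "GL_equilibrium c1 c2 \<delta> =
      vector [sqrt c2 / (sqrt c1 + sqrt c2) * (1 / sqrt (2 * sqrt (c1 * c2))),
              sqrt c1 / (sqrt c1 + sqrt c2) * (1 / sqrt (2 * sqrt (c1 * c2)))]"
proof -
  let ?a = "sqrt c2 / (sqrt c1 + sqrt c2) * (1 / sqrt (2 * sqrt (c1 * c2)))"
  let ?b = "sqrt c1 / (sqrt c1 + sqrt c2) * (1 / sqrt (2 * sqrt (c1 * c2)))"
  have ab: "0 < ?a" "0 < ?b"
    using assms by (auto intro!: mult_pos_pos divide_pos_pos add_pos_pos)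
  have *: "0 < x$1 \<and> 0 < x$2 \<and> GL_map c1 c2 \<delta> x = x \<longleftrightarrow> x = vector [?a, ?b]" for x :: "real^2"
  proof (cases "0 < x$1 \<and> 0 < x$2")
    case True
    have "0 < 1 + c2 * (x$1 + x$2)^2" using assms by (simp add: add_pos_nonneg)
    then have "(2 * x$2 + x$1) / (2 * (1 + c2 * (x$1 + x$2)^2)) = x$2 \<longleftrightarrow>
        2 * x$2 + x$1 = x$2 * (2 * (1 + c2 * (x$1 + x$2)^2))"
      by (simp add: divide_eq_eq)
    also have "\<dots> \<longleftrightarrow> x$1 - 2 * c2 * x$2 * (x$2 + x$1)^2 = 0"
      by (auto simp: algebra_simps)
    finally have "GL_map c1 c2 \<delta> x = x \<longleftrightarrow>
        G1 c1 (x$1) (x$2) = 0 \<and> x$1 - 2 * c2 * x$2 * (x$2 + x$1)^2 = 0"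
      using assms by (simp add: GL_map_def vec_eq_iff forall_2)
    also have "\<dots> \<longleftrightarrow> x = vector [?a, ?b]"
      using equilibrium_equations_iff[OF assms(1,2), of "x$1" "x$2"] True
      by (simp add: vec_eq_iff forall_2)
    finally show ?thesis using True by blast
  next
    case False
    then show ?thesis using ab by (metis vector_2)
  qed
  show "0 < x$1 \<and> 0 < x$2 \<and> GL_map c1 c2 \<delta> x = x \<longleftrightarrow> x = vector [?a, ?b]" by (rule *)
  show "GL_equilibrium c1 c2 \<delta> = vector [?a, ?b]"
    unfolding GL_equilibrium_def * by (rule the_eq_trivial)
qed

end

theory Submission
  imports Defs
begin

text \<open>With \<open>(x, y)\<close> the equilibrium, GR has the multiplier
  \<open>1 - 4\<delta>y / ((x + y)(x + 3y))\<close>, so it is stable iff \<open>2\<delta>y < (x + y)(x + 3y)\<close>. For GL, with trace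
  \<open>T\<close> and determinant \<open>D\<close> of the Jacobian, the Jury conditions \<open>\<bar>T\<bar> < 1 + D\<close> and \<open>D < 1\<close> follow from
  this: at the boundary value of \<open>\<delta>\<close> the quantity \<open>1 + T + D\<close> is a positive multiple of \<open>(x - y)\<^sup>2\<close>.
  The same formula shows that GL is still stable on that boundary if \<open>x \<noteq> y\<close>, which gives strictness.\<close>

section \<open>Differentiability of the implicitly defined reply \<open>R2\<close>\<close>

lemma R2_pos_and_eq:
  assumes "0 < c2" "0 < x"
  shows "0 < R2 c2 x" "x = 2 * c2 * R2 c2 x * (R2 c2 x + x)^2"
  using R2_eq_iff[OF assms, of "R2 c2 x"] by auto

text \<open>Implicit differentiation in exact form: the two cubics are subtracted, and v (v + u)^2 -
  y (y + x)^2 is split as (v - y) (v + u)^2 + y ((v + u)^2 - (y + x)^2), whose last bracket contains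
  the factor (v - y) + (u - x). Dividing gives a difference quotient rational in u and v.\<close>

lemma R2_difference:
  assumes c: "0 < c2" and pos: "0 < x" "0 < u"
  defines "y \<equiv> R2 c2 x" and "v \<equiv> R2 c2 u"
  shows "(v - y) * (2 * c2 * ((v + u)^2 + y * (v + u + y + x))) =
    (u - x) * (1 - 2 * c2 * (y * (v + u + y + x)))"
proof -
  have "x = 2 * c2 * y * (y + x)^2" "u = 2 * c2 * v * (v + u)^2"
    using R2_pos_and_eq[OF c] pos by (simp_all add: y_def v_def)
  then have "u - x = 2 * c2 * v * (v + u)^2 - 2 * c2 * y * (y + x)^2" by linarith
  then show ?thesis by algebra
qed

lemma R2_lipschitz_at:
  assumes c: "0 < c2" and pos: "0 < x" "0 < u"
  shows "\<bar>R2 c2 u - R2 c2 x\<bar> \<le> \<bar>u - x\<bar> * (1 + 1 / (2 * c2 * (R2 c2 x * x)))"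
proof -
  define y where "y = R2 c2 x"
  define v where "v = R2 c2 u"
  define B where "B = y * (v + u + y + x)"
  define A where "A = (v + u)^2 + B"
  have y: "0 < y" and v: "0 < v" using R2_pos_and_eq[OF c] pos by (simp_all add: y_def v_def)
  \<comment> \<open>The lower bound y x is free of u and v, which makes the Lipschitz constant
    independent of u.\<close>
  have "B = y * x + y * (v + u + y)" by (simp add: B_def algebra_simps)
  then have B: "y * x \<le> B" using y v pos by simp
  have yx: "0 < y * x" using y pos by simp
  have AB: "B \<le> A" by (simp add: A_def)
  have A: "0 < A" using AB B yx by linarith
  have "v - y = (u - x) * ((1 - 2 * c2 * B) / (2 * c2 * A))"
  proof -
    have "(v - y) * (2 * c2 * A) = (u - x) * (1 - 2 * c2 * B)"
      using R2_difference[OF c pos] by (simp add: A_def B_def y_def v_def)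
    then show ?thesis using A c by (simp add: eq_divide_eq)
  qed
  then have "\<bar>v - y\<bar> = \<bar>u - x\<bar> * \<bar>1 / (2 * c2 * A) - B / A\<bar>"
    using c A by (simp add: abs_mult diff_divide_distrib)
  also have "\<bar>1 / (2 * c2 * A) - B / A\<bar> \<le> 1 + 1 / (2 * c2 * (y * x))"
  proof -
    have "1 / (2 * c2 * A) \<le> 1 / (2 * c2 * (y * x))"
      using c A AB B yx by (intro divide_left_mono mult_left_mono) auto
    moreover have "0 \<le> 1 / (2 * c2 * A)" using c A by simp
    moreover have "B / A \<le> 1" "0 \<le> B / A" using A AB B yx by simp_all
    ultimately show ?thesis by linarith
  qed
  finally show ?thesis by (simp add: y_def v_def mult_left_mono)
qed

lemma isCont_R2:
  assumes c: "0 < c2" and pos: "0 < x"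
  shows "isCont (R2 c2) x"
proof -
  let ?L = "1 + 1 / (2 * c2 * (R2 c2 x * x))"
  have "((\<lambda>u. R2 c2 u - R2 c2 x) \<longlongrightarrow> 0) (at x)"
  proof (rule Lim_null_comparison)
    have "eventually (\<lambda>u. 0 < u) (at x)"
      using order_tendstoD(1)[OF tendsto_ident_at pos] .
    then show "eventually (\<lambda>u. norm (R2 c2 u - R2 c2 x) \<le> \<bar>u - x\<bar> * ?L) (at x)"
      by eventually_elim (use R2_lipschitz_at[OF c pos] in simp)
    have "((\<lambda>u. \<bar>u - x\<bar> * ?L) \<longlongrightarrow> \<bar>x - x\<bar> * ?L) (at x)"
      by (intro tendsto_intros)
    then show "((\<lambda>u. \<bar>u - x\<bar> * ?L) \<longlongrightarrow> 0) (at x)" by simp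
  qed
  then show ?thesis using LIM_zero_cancel isCont_def by blast
qed

text \<open>The exact difference quotient has a positive denominator, so continuity of
  \<open>R2\<close> at x is enough to pass to the limit v = y, u = x.\<close>

lemma has_field_derivative_R2:
  assumes c: "0 < c2" and pos: "0 < x"
  defines "y \<equiv> R2 c2 x"
  shows "(R2 c2 has_field_derivative
     (1 - 4 * c2 * y * (x + y)) / (2 * c2 * (x + y) * (x + 3 * y))) (at x)"
proof -
  let ?A = "\<lambda>u v. 2 * c2 * ((v + u)^2 + y * (v + u + y + x))"
  let ?B = "\<lambda>u v. 1 - 2 * c2 * (y * (v + u + y + x))"
  have y: "0 < y" using R2_pos_and_eq[OF c pos] by (simp add: y_def)
  have A: "0 < ?A u v" if "0 < u" "0 < v" for u v
    using c y pos that by (intro mult_pos_pos add_pos_pos) auto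
  have lim: "(R2 c2 \<longlongrightarrow> y) (at x)"
    using isCont_R2[OF c pos] by (simp add: isCont_def y_def)
  have "((\<lambda>u. ?B u (R2 c2 u) / ?A u (R2 c2 u)) \<longlongrightarrow> ?B x y / ?A x y) (at x)"
    using A[OF pos y] by (intro tendsto_intros lim) auto
  also have "?B x y = 1 - 4 * c2 * y * (x + y)" by (simp add: algebra_simps)
  also have "?A x y = 2 * c2 * (x + y) * (x + 3 * y)"
    by (simp add: algebra_simps power2_eq_square)
  finally have "((\<lambda>u. ?B u (R2 c2 u) / ?A u (R2 c2 u)) \<longlongrightarrow>
      (1 - 4 * c2 * y * (x + y)) / (2 * c2 * (x + y) * (x + 3 * y))) (at x)" .
  moreover have "eventually (\<lambda>u. ?B u (R2 c2 u) / ?A u (R2 c2 u) =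
      (R2 c2 u - R2 c2 x) / (u - x)) (at x)"
  proof -
    have "eventually (\<lambda>u. 0 < u \<and> u \<noteq> x) (at x)"
      using order_tendstoD(1)[OF tendsto_ident_at pos]
      by (auto simp: eventually_conj_iff eventually_neq_at_within)
    then show ?thesis
    proof eventually_elim
      case (elim u)
      then have "0 < ?A u (R2 c2 u)" using A R2_pos_and_eq[OF c] by blast
      then show ?case
        using elim R2_difference[OF c pos, of u, folded y_def]
        by (subst frac_eq_eq) (auto simp: mult.commute y_def)
    qed
  qed
  ultimately show ?thesis
    unfolding has_field_derivative_iff by (rule Lim_transform_eventually)
qed

section \<open>Equilibrium coordinates as parameters, and stability of GR\<close>

text \<open>From here on the parameters \<open>c1\<close>, \<open>c2\<close> are expressed through the coordinates \<open>x\<close>, \<open>y\<close> of the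
  equilibrium, which turns all stability conditions into polynomial inequalities.\<close>

lemma equilibrium_parametrization:
  assumes c: "0 < c1" "0 < c2" and d: "0 < \<delta>"
  obtains x y where "0 < x" "0 < y" "GR_equilibrium c1 c2 \<delta> = x" "R2 c2 x = y"
    "GL_equilibrium c1 c2 \<delta> = vector [x, y]"
    "c1 = y / (2 * x * (x + y)^2)" "c2 = x / (2 * y * (x + y)^2)"
proof -
  let ?a = "sqrt c2 / (sqrt c1 + sqrt c2) * (1 / sqrt (2 * sqrt (c1 * c2)))"
  let ?b = "sqrt c1 / (sqrt c1 + sqrt c2) * (1 / sqrt (2 * sqrt (c1 * c2)))"
  have ab: "0 < ?a" "0 < ?b"
    using c by (auto intro!: mult_pos_pos divide_pos_pos add_pos_pos)
  have eq: "G1 c1 ?a ?b = 0" "?a - 2 * c2 * ?b * (?b + ?a)^2 = 0"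
    using equilibrium_equations_iff[OF c ab] by blast+
  \<comment> \<open>Solving for \<open>c1\<close> and \<open>c2\<close> at arbitrary x and y keeps
    the square roots of \<open>?a\<close> and \<open>?b\<close> out of the algebra.\<close>
  have c1: "c1 = y / (2 * x * (x + y)^2)" if "G1 c1 x y = 0" "0 < x" "0 < y" for x y
  proof -
    have "x + y \<noteq> 0" using that by simp
    then have "x * y = 2 * c1 * x^2 * (x + y)^2"
      using that(1) by (simp add: G1_def divide_eq_eq)
    then have "x * y = x * (c1 * (2 * x * (x + y)^2))" by algebra
    then have "c1 * (2 * x * (x + y)^2) = y" using that by simp
    then show ?thesis using that by (simp add: eq_divide_eq)
  qed
  have c2: "c2 = x / (2 * y * (x + y)^2)"
    if "x - 2 * c2 * y * (y + x)^2 = 0" "0 < x" "0 < y" for x y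
    using that by (simp add: field_simps)
  show thesis
    using GR_positive_equilibrium(2,3)[OF c d] GL_positive_equilibrium(2)[OF c d]
      c1[OF eq(1) ab] c2[OF eq(2) ab] ab that by blast
qed

text \<open>Stated along general f and g so that one computation serves both models: the identity
  and \<open>R2\<close> for GR, the two coordinate projections for GL.\<close>

lemma G1_has_derivative:
  fixes x y :: real
  assumes pos: "0 < x" "0 < y" and c1: "c1 = y / (2 * x * (x + y)^2)"
    and f: "(f has_derivative f') (at z within S)" "f z = x"
    and g: "(g has_derivative g') (at z within S)" "g z = y"
  shows "((\<lambda>z. G1 c1 (f z) (g z)) has_derivative
    (\<lambda>h. - (y * (3 * x + y) / (x + y)^3) * f' h + x * (x - y) / (x + y)^3 * g' h)) (at z within S)"
proof -
  have w: "x + y \<noteq> 0" using pos by simp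
  let ?G' = "\<lambda>h. ((x * g' h + f' h * y) * (x + y)^2 - x * y * ((2 * f' h + 2 * g' h) * (x + y))) /
      ((x + y)^2 * (x + y)^2) - 2 * c1 * (2 * x * f' h)"
  have "((\<lambda>z. G1 c1 (f z) (g z)) has_derivative ?G') (at z within S)"
    unfolding G1_def
    using has_derivative_diff[OF has_derivative_divide'[OF has_derivative_mult[OF f(1) g(1)]
          has_derivative_power[OF has_derivative_add[OF f(1) g(1)], of 2]]
        has_derivative_mult_right[OF has_derivative_power[OF f(1), of 2], of "2 * c1"]] w
    by (simp add: f(2) g(2) mult_ac)
  also have "?G' = (\<lambda>h. - (y * (3 * x + y) / (x + y)^3) * f' h + x * (x - y) / (x + y)^3 * g' h)"
  proof
    fix h
    show "?G' h = - (y * (3 * x + y) / (x + y)^3) * f' h + x * (x - y) / (x + y)^3 * g' h"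
      unfolding c1 using pos w by (simp add: divide_simps) algebra
  qed
  finally show ?thesis .
qed

lemma locally_stable_1d_GR_iff:
  assumes pos: "0 < x" "0 < y" and d: "0 < \<delta>" and R: "R2 c2 x = y"
    and c1: "c1 = y / (2 * x * (x + y)^2)" and c2: "c2 = x / (2 * y * (x + y)^2)"
  shows "locally_stable_1d (GR_map c1 c2 \<delta>) x \<longleftrightarrow> 2 * \<delta> * y < (x + y) * (x + 3 * y)"
proof -
  let ?D = "1 - 4 * \<delta> * y / ((x + y) * (x + 3 * y))"
  have c2_pos: "0 < c2" using pos by (simp add: c2)
  have "(1 - 4 * c2 * y * (x + y)) / (2 * c2 * (x + y) * (x + 3 * y)) =
      y * (y - x) / (x * (x + 3 * y))"
  proof -
    have "x + y \<noteq> 0" "x + 3 * y \<noteq> 0" using pos by simp_all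
    then show ?thesis
      using pos unfolding c2 by (simp add: divide_simps) algebra
  qed
  then have R': "(R2 c2 has_field_derivative y * (y - x) / (x * (x + 3 * y))) (at x)"
    using has_field_derivative_R2[OF c2_pos pos(1)] by (simp add: R)
  have "(GR_map c1 c2 \<delta> has_derivative (\<lambda>h. h + \<delta> *
      (- (y * (3 * x + y) / (x + y)^3) * h +
        x * (x - y) / (x + y)^3 * (y * (y - x) / (x * (x + 3 * y)) * h)))) (at x)"
    unfolding GR_map_def
    using R'[unfolded has_field_derivative_def]
    by (intro has_derivative_add has_derivative_ident has_derivative_mult_right
        G1_has_derivative[OF pos c1] refl R)
  also have "(\<lambda>h. h + \<delta> * (- (y * (3 * x + y) / (x + y)^3) * h +
        x * (x - y) / (x + y)^3 * (y * (y - x) / (x * (x + 3 * y)) * h))) = (*) ?D"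
  proof
    fix h
    have nz: "x + y \<noteq> 0" "x + 3 * y \<noteq> 0" "x \<noteq> 0" using pos by simp_all
    \<comment> \<open>The square of x + y cancels because (3x + y)(x + 3y) + (x - y)^2 = 4 (x +
      y)^2.\<close>
    have "- (y * (3 * x + y) / (x + y)^3) +
        x * (x - y) / (x + y)^3 * (y * (y - x) / (x * (x + 3 * y))) =
        - (4 * y / ((x + y) * (x + 3 * y)))"
      using nz by (simp add: divide_simps) algebra
    then show "h + \<delta> * (- (y * (3 * x + y) / (x + y)^3) * h +
        x * (x - y) / (x + y)^3 * (y * (y - x) / (x * (x + 3 * y)) * h)) = ?D * h"
      by algebra
  qed
  finally have "(GR_map c1 c2 \<delta> has_field_derivative ?D) (at x)"
    by (simp add: has_field_derivative_def)
  then have "GR_map c1 c2 \<delta> differentiable (at x)" "deriv (GR_map c1 c2 \<delta>) x = ?D"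
    by (auto simp: real_differentiable_def DERIV_imp_deriv)
  \<comment> \<open>The multiplier is 1 minus a positive quantity, so only the lower bound -1
    restricts \<delta>.\<close>
  moreover have "\<bar>?D\<bar> < 1 \<longleftrightarrow> 2 * \<delta> * y < (x + y) * (x + 3 * y)"
  proof -
    have "0 < (x + y) * (x + 3 * y)" "0 < 4 * \<delta> * y / ((x + y) * (x + 3 * y))"
      using pos d by simp_all
    then show ?thesis by (auto simp: abs_less_iff divide_less_eq)
  qed
  ultimately show ?thesis by (simp add: locally_stable_1d_def)
qed

section \<open>Eigenvalues of two-by-two matrices in the unit disk\<close>

text \<open>For a real root r the other root is T - r, and the values of the polynomial at 1 and -1
  factor over both roots. If r were at least 1 or at most -1, the other root would lie beyond the
  same end, forcing the product D to be at least 1. A non-real root has real part T / 2, and its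
  squared modulus is D.\<close>

lemma jury_criterion:
  fixes T D :: real and \<mu> :: complex
  assumes root: "\<mu>^2 - of_real T * \<mu> + of_real D = 0"
    and jury: "0 < 1 - T + D" "0 < 1 + T + D" "D < 1"
  shows "norm \<mu> < 1"
proof -
  define r where "r = Re \<mu>"
  define m where "m = Im \<mu>"
  have re: "r^2 - m^2 - T * r + D = 0" and im: "m * (2 * r - T) = 0"
    using root by (auto simp: complex_eq_iff power2_eq_square r_def m_def algebra_simps)
  have "r^2 + m^2 < 1"
  proof (cases "m = 0")
    case True
    have D: "D = r * (T - r)" using re True by (simp add: power2_eq_square algebra_simps)
    have "0 < (1 - r) * (1 - (T - r))" "0 < (1 + r) * (1 + (T - r))"
      using jury D by (simp_all add: algebra_simps)
    have "\<bar>r\<bar> < 1"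
    proof (rule ccontr)
      assume "\<not> \<bar>r\<bar> < 1"
      then consider "1 \<le> r" | "1 \<le> - r" by linarith
      then show False
      proof cases
        case 1
        then have "1 < T - r"
          using \<open>0 < (1 - r) * (1 - (T - r))\<close> by (simp add: zero_less_mult_iff)
        then show False using jury(3) D 1 mult_mono[of 1 r 1 "T - r"] by simp
      next
        case 2
        then have "1 < - (T - r)"
          using \<open>0 < (1 + r) * (1 + (T - r))\<close> by (simp add: zero_less_mult_iff)
        then show False using jury(3) D 2 mult_mono[of 1 "- r" 1 "- (T - r)"]
          by (simp add: algebra_simps)
      qed
    qed
    then show ?thesis using True by (simp add: abs_square_less_1)
  next
    case False
    then have "T = 2 * r" using im by simp
    then show ?thesis using re jury(3) by (simp add: power2_eq_square)
  qed
  then have "(norm \<mu>)^2 < 1" by (simp add: cmod_power2 r_def m_def)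
  then show ?thesis by (simp add: abs_square_less_1)
qed

text \<open>Eliminating either coordinate from the eigenvector equations shows that the
  characteristic polynomial at \<mu> annihilates both coordinates of v, one of which is
  nonzero.\<close>

lemma matrix_eigenvalue_2_root:
  fixes A :: "complex^2^2"
  assumes "matrix_eigenvalue A \<mu>"
  shows "\<mu>^2 - (A$1$1 + A$2$2) * \<mu> + (A$1$1 * A$2$2 - A$1$2 * A$2$1) = 0"
proof -
  obtain v where v: "v \<noteq> 0" "A *v v = \<mu> *s v"
    using assms by (auto simp: matrix_eigenvalue_def)
  have 1: "A$1$1 * v$1 + A$1$2 * v$2 = \<mu> * v$1" and 2: "A$2$1 * v$1 + A$2$2 * v$2 = \<mu> * v$2"
    using v(2) by (simp_all add: vec_eq_iff forall_2 matrix_vector_mult_def sum_2)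
  let ?P = "\<mu>^2 - (A$1$1 + A$2$2) * \<mu> + (A$1$1 * A$2$2 - A$1$2 * A$2$1)"
  have "?P * v$1 = 0" "?P * v$2 = 0" using 1 2 by algebra+
  then show ?thesis using v(1) by (auto simp: vec_eq_iff forall_2)
qed

section \<open>Jacobian and stability of GL\<close>

lemma GL_map_has_derivative:
  fixes x y c1 c2 \<delta> :: real
  assumes pos: "0 < x" "0 < y"
    and c1: "c1 = y / (2 * x * (x + y)^2)" and c2: "c2 = x / (2 * y * (x + y)^2)"
  defines "J \<equiv> vector [vector [1 - \<delta> * (y * (3 * x + y) / (x + y)^3), \<delta> * (x * (x - y) / (x + y)^3)],
      vector [y * (y - x) / ((x + y) * (x + 2 * y)), 2 * y^2 / ((x + y) * (x + 2 * y))]] :: real^2^2"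
  shows "(GL_map c1 c2 \<delta> has_derivative (\<lambda>h. J *v h)) (at (vector [x, y]))"
proof -
  let ?z = "vector [x, y] :: real^2"
  have nth: "((\<lambda>z. z$i) has_derivative (\<lambda>h. h$i)) (at ?z)" for i
    by (intro bounded_linear_imp_has_derivative bounded_linear_vec_nth)
  let ?F = "\<lambda>z::real^2. (2 * z$2 + z$1) / (2 * (1 + c2 * (z$1 + z$2)^2))"
  have 1: "((\<lambda>z. z$1 + \<delta> * G1 c1 (z$1) (z$2)) has_derivative (\<lambda>h. (J *v h)$1)) (at ?z)"
  proof -
    have "((\<lambda>z::real^2. z$1 + \<delta> * G1 c1 (z$1) (z$2)) has_derivative (\<lambda>h. h$1 + \<delta> *
        (- (y * (3 * x + y) / (x + y)^3) * h$1 + x * (x - y) / (x + y)^3 * h$2))) (at ?z)"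
      by (intro has_derivative_add has_derivative_mult_right G1_has_derivative[OF pos c1] nth) simp_all
    also have "(\<lambda>h::real^2. h$1 + \<delta> *
        (- (y * (3 * x + y) / (x + y)^3) * h$1 + x * (x - y) / (x + y)^3 * h$2)) = (\<lambda>h. (J *v h)$1)"
      by (simp add: fun_eq_iff J_def matrix_vector_mult_def sum_2 algebra_simps)
    finally show ?thesis .
  qed
  have 2: "(?F has_derivative (\<lambda>h. (J *v h)$2)) (at ?z)"
  proof -
    have w: "x + y \<noteq> 0" "x + 2 * y \<noteq> 0" using pos by simp_all
    \<comment> \<open>\<open>k\<close> and \<open>kw\<close> eliminate \<open>c2\<close>, leaving a
      rational identity in x and y with nonzero denominators.\<close>
    have k: "1 + c2 * (x + y)^2 = (x + 2 * y) / (2 * y)"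
      using pos w by (simp add: c2 field_simps)
    have k0: "1 + c2 * (x + y)^2 \<noteq> 0" using pos unfolding k by simp
    have kw: "c2 * (x + y) = x / (2 * y * (x + y))"
      using pos w by (simp add: c2 power2_eq_square)
    let ?F' = "\<lambda>h::real^2. ((2 * h$2 + h$1) * (2 * (1 + c2 * (x + y)^2)) -
        (2 * y + x) * (c2 * (x + y) * (4 * h$1 + 4 * h$2))) /
        ((2 * (1 + c2 * (x + y)^2)) * (2 * (1 + c2 * (x + y)^2)))"
    have "(?F has_derivative ?F') (at ?z)"
      using has_derivative_divide'[OF
          has_derivative_add[OF has_derivative_mult_right[OF nth[of 2], of 2] nth[of 1]]
          has_derivative_mult_right[OF has_derivative_add[OF has_derivative_const[of 1]
            has_derivative_mult_right[OF has_derivative_power[OF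
              has_derivative_add[OF nth[of 1] nth[of 2]], of 2], of c2]], of 2]] k0
      by (simp add: mult_ac)
    also have "?F' = (\<lambda>h. (J *v h)$2)"
    proof
      fix h :: "real^2"
      show "?F' h = (J *v h)$2"
        unfolding k kw J_def using pos w
        by (simp add: matrix_vector_mult_def sum_2 divide_simps) algebra
    qed
    finally show ?thesis .
  qed
  \<comment> \<open>Written as a combination of the axis vectors, the map can be differentiated
    componentwise by the sum and scaling rules.\<close>
  have "((\<lambda>z. (z$1 + \<delta> * G1 c1 (z$1) (z$2)) *\<^sub>R axis 1 1 + ?F z *\<^sub>R axis 2 1 :: real^2)
      has_derivative (\<lambda>h. (J *v h)$1 *\<^sub>R axis 1 1 + (J *v h)$2 *\<^sub>R axis 2 1)) (at ?z)"
    by (intro has_derivative_add has_derivative_scaleR_left 1 2)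
  also have "(\<lambda>h. (J *v h)$1 *\<^sub>R axis 1 1 + (J *v h)$2 *\<^sub>R axis 2 1) = (\<lambda>h. J *v h)"
    by (simp add: fun_eq_iff vec_eq_iff forall_2 axis_def)
  also have "(\<lambda>z. (z$1 + \<delta> * G1 c1 (z$1) (z$2)) *\<^sub>R axis 1 1 + ?F z *\<^sub>R axis 2 1 :: real^2) =
      GL_map c1 c2 \<delta>"
    by (simp add: fun_eq_iff vec_eq_iff forall_2 axis_def GL_map_def)
  finally show ?thesis .
qed

text \<open>The hypotheses admit the GR boundary when x and y differ, so the same lemma yields both
  the inclusion and its strictness.\<close>

lemma locally_stable_GL:
  assumes pos: "0 < x" "0 < y" "0 < \<delta>"
    and c1: "c1 = y / (2 * x * (x + y)^2)" and c2: "c2 = x / (2 * y * (x + y)^2)"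
    and le: "2 * \<delta> * y \<le> (x + y) * (x + 3 * y)"
    and strict: "2 * \<delta> * y < (x + y) * (x + 3 * y) \<or> x \<noteq> y"
  shows "locally_stable (GL_map c1 c2 \<delta>) (vector [x, y])"
proof -
  define J :: "real^2^2" where
    "J = vector [vector [1 - \<delta> * (y * (3 * x + y) / (x + y)^3), \<delta> * (x * (x - y) / (x + y)^3)],
      vector [y * (y - x) / ((x + y) * (x + 2 * y)), 2 * y^2 / ((x + y) * (x + 2 * y))]]"
  define T where "T = J$1$1 + J$2$2"
  define D where "D = J$1$1 * J$2$2 - J$1$2 * J$2$1"
  have deriv: "(GL_map c1 c2 \<delta> has_derivative (\<lambda>h. J *v h)) (at (vector [x, y]))"
    using GL_map_has_derivative[OF pos(1,2) c1 c2] by (simp add: J_def)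
  then have "frechet_derivative (GL_map c1 c2 \<delta>) (at (vector [x, y])) = (\<lambda>h. J *v h)"
    by (rule frechet_derivative_at[symmetric])
  then have jac: "jacobian (GL_map c1 c2 \<delta>) (at (vector [x, y])) = J"
    by (simp add: jacobian_def)
  let ?w = "x + y"
  have w: "0 < ?w" "0 < x + 2 * y" using pos by simp_all
  have nz: "?w \<noteq> 0" "x + 2 * y \<noteq> 0" using w by simp_all
  have "1 - T + D = 4 * \<delta> * x * y / (?w^2 * (x + 2 * y))"
    using nz by (simp add: T_def D_def J_def divide_simps) algebra
  then have jury1: "0 < 1 - T + D" using pos w by simp
  have "1 + T + D = 2 * (?w^2 * (x^2 + 3 * x * y + 4 * y^2) - \<delta> * y * (x^2 + 5 * x * y + 2 * y^2)) /
      (?w^3 * (x + 2 * y))"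
    using nz by (simp add: T_def D_def J_def divide_simps) algebra
  moreover have "2 * \<delta> * y * (x^2 + 5 * x * y + 2 * y^2) < 2 * ?w^2 * (x^2 + 3 * x * y + 4 * y^2)"
  proof -
    have q: "0 < x^2 + 5 * x * y + 2 * y^2" using pos by (simp add: add_pos_pos)
    \<comment> \<open>The first summand is the left side of the goal with 2\<delta>y replaced by its
      boundary value; the second is the slack left on that boundary, zero only for x = y. Either
      alternative in \<open>strict\<close> makes one of the two comparisons strict.\<close>
    have "2 * ?w^2 * (x^2 + 3 * x * y + 4 * y^2) =
        ?w * (x + 3 * y) * (x^2 + 5 * x * y + 2 * y^2) + ?w * (x + 2 * y) * (x - y)^2"
      by algebra
    moreover have "2 * \<delta> * y * (x^2 + 5 * x * y + 2 * y^2) \<le>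
        ?w * (x + 3 * y) * (x^2 + 5 * x * y + 2 * y^2)"
      using le q by (intro mult_right_mono) auto
    moreover have "0 \<le> ?w * (x + 2 * y) * (x - y)^2" using w by simp
    moreover have "2 * \<delta> * y * (x^2 + 5 * x * y + 2 * y^2) <
        ?w * (x + 3 * y) * (x^2 + 5 * x * y + 2 * y^2) \<or> 0 < ?w * (x + 2 * y) * (x - y)^2"
      using strict q w by auto
    ultimately show ?thesis by linarith
  qed
  ultimately have jury2: "0 < 1 + T + D" using w by (simp add: mult.assoc)
  have "1 - D = (x * (x + 3 * y) * ?w^2 - \<delta> * y * (x^2 - 3 * x * y - 2 * y^2)) /
      (?w^3 * (x + 2 * y))"
    using nz by (simp add: D_def J_def divide_simps) algebra
  moreover have "\<delta> * y * (x^2 - 3 * x * y - 2 * y^2) < x * (x + 3 * y) * ?w^2"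
  proof -
    \<comment> \<open>The intermediate factor 2x(x + y) is chosen so that the bound on 2\<delta>y
      turns it into exactly the right-hand side.\<close>
    have "\<delta> * y * (x^2 - 3 * x * y - 2 * y^2) < \<delta> * y * (2 * x * ?w)"
    proof (intro mult_strict_left_mono)
      have "2 * x * ?w - (x^2 - 3 * x * y - 2 * y^2) = x^2 + 5 * x * y + 2 * y^2"
        by algebra
      also have "\<dots> > 0" using pos by (simp add: add_pos_pos)
      finally show "x^2 - 3 * x * y - 2 * y^2 < 2 * x * ?w" by simp
    qed (use pos in simp)
    also have "\<dots> = 2 * \<delta> * y * (x * ?w)" by simp
    also have "\<dots> \<le> ?w * (x + 3 * y) * (x * ?w)"
      using le pos w by (intro mult_right_mono) auto
    also have "\<dots> = x * (x + 3 * y) * ?w^2" by algebra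
    finally show ?thesis .
  qed
  ultimately have "0 < 1 - D" using w by simp
  then have jury3: "D < 1" by simp
  have "norm \<mu> < 1" if "matrix_eigenvalue (map_matrix complex_of_real J) \<mu>" for \<mu>
  proof (rule jury_criterion[OF _ jury1 jury2 jury3])
    show "\<mu>^2 - of_real T * \<mu> + of_real D = 0"
      using matrix_eigenvalue_2_root[OF that] by (simp add: T_def D_def map_matrix_def)
  qed
  then show ?thesis
    using deriv by (auto simp: locally_stable_def jac differentiable_def)
qed

section \<open>Comparison of the two stability regions\<close>

theorem proposition4:
  shows "Omega_GR \<subset> Omega_GL"
proof
  show "Omega_GR \<subseteq> Omega_GL"
  proof
    fix t assume t: "t \<in> Omega_GR"
    then obtain c1 c2 \<delta> where t_eq: "t = (c1, c2, \<delta>)" and c: "0 < c1" "0 < c2" and d: "0 < \<delta>"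
      and stable: "locally_stable_1d (GR_map c1 c2 \<delta>) (GR_equilibrium c1 c2 \<delta>)"
      by (auto simp: Omega_GR_def)
    obtain x y where xy: "0 < x" "0 < y" "GR_equilibrium c1 c2 \<delta> = x" "R2 c2 x = y"
      "GL_equilibrium c1 c2 \<delta> = vector [x, y]"
      "c1 = y / (2 * x * (x + y)^2)" "c2 = x / (2 * y * (x + y)^2)"
      using equilibrium_parametrization[OF c d] .
    have "2 * \<delta> * y < (x + y) * (x + 3 * y)"
      using stable locally_stable_1d_GR_iff[OF xy(1,2) d xy(4,6,7)] xy(3) by simp
    then have "locally_stable (GL_map c1 c2 \<delta>) (vector [x, y])"
      using locally_stable_GL[OF xy(1,2) d xy(6,7)] by simp
    then show "t \<in> Omega_GL" using c d xy(5) by (simp add: Omega_GL_def t_eq)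
  qed
next
  \<comment> \<open>a point with \<open>x \<noteq> y\<close> on the boundary \<open>2\<delta>y = (x + y)(x + 3y)\<close>, where the GR multiplier is \<open>-1\<close>\<close>
  have c: "0 < (1::real)" "0 < (4::real)" and d: "0 < (5 / 4::real)" by simp_all
  \<comment> \<open>With \<open>c1 = 1\<close> and \<open>c2 = 4\<close> every square root in the
    equilibrium formula is rational. The boundary equation \<delta>/3 = (1/2)(5/6) then gives
    \<delta> = 5/4.\<close>
  have eq: "GR_equilibrium 1 4 (5/4) = 1/3" "R2 4 (1/3) = 1/6"
    "GL_equilibrium 1 4 (5/4) = vector [1/3, 1/6]"
    using GR_positive_equilibrium(2,3)[OF c d] GL_positive_equilibrium(2)[OF c d]
    by (simp_all add: real_sqrt_mult)
  have par: "(1::real) = (1/6) / (2 * (1/3) * (1/3 + 1/6)^2)"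
    "(4::real) = (1/3) / (2 * (1/6) * (1/3 + 1/6)^2)"
    by (simp_all add: power2_eq_square)
  have "\<not> locally_stable_1d (GR_map 1 4 (5/4)) (1/3)"
    by (subst locally_stable_1d_GR_iff[OF _ _ d eq(2) par]) simp_all
  moreover have "locally_stable (GL_map 1 4 (5/4)) (vector [1/3, 1/6])"
    by (rule locally_stable_GL[OF _ _ d par]) simp_all
  ultimately have "(1, 4, 5/4) \<in> Omega_GL - Omega_GR"
    by (simp add: Omega_GR_def Omega_GL_def eq)
  then show "Omega_GR \<noteq> Omega_GL" by blast
qed

end
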